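(* Let $R$ be a commutative ring with identity and let $N$ be a submodule of an $R$-module $M$. Then the following implications hold: $N$ is a second submodule of $M$ $\Rightarrow$ $N$ is a weakly second submodule of $M$ $\Rightarrow$ $N$ is a strongly 2-absorbing second submodule of $M$ $\Rightarrow$ $N$ is a 2-absorbing second submodule of $M$. In general, none of these three implications is reversible; that is, for each of the three implications there exist a commutative ring $R$ with identity, an $R$-module $M$ and a submodule $N$ of $M$ for which the converse of that implication fails.
   Context: All rings are commutative with identity. For a submodule $N$ of $M$, $Ann_R(N)=\{r\in R: rN=0\}$. A proper submodule $L$ of $M$ is completely irreducible if $L=\bigcap_{i\in I}N_i$, with $\{N_i\}_{i\in I}$ a family of submodules of $M$, implies $L=N_i$ for some $i\in I$. A non-zero submodule $N$ of $M$ is: - second if for each $a\in R$ the homomorphism $N\to N$, $x\mapsto ax$, is either surjective or zero; - weakly second if whenever $r,s\in R$, $K$ is a submodule of $M$ and $rsN\subseteq K$, then $rN\subseteq K$ or $sN\subseteq K$; - strongly 2-absorbing second if whenever $a,b\in R$, $L_1,L_2$ are completely irreducible submodules of $M$ and $abN\subseteq L_1\cap L_2$, then $aN\subseteq L_1\cap L_2$ or $bN\subseteq L_1\cap L_2$ or $ab\in Ann_R(N)$; - 2-absorbing second if whenever $a,b\in R$, $L$ is a completely irreducible submodule of $M$ and $abN\subseteq L$, then $aN\subseteq L$ or $bN\subseteq L$ or $ab\in Ann_R(N)$. *)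

theory Defs
  imports Complex_Main "HOL-Algebra.Module"
begin

definition scaled :: "('a, 'b, 'm) module_scheme \<Rightarrow> 'a \<Rightarrow> 'b set \<Rightarrow> 'b set"
  where "scaled M r N = (\<lambda>x. r \<odot>\<^bsub>M\<^esub> x) ` N"

definition Ann :: "('a, 'c) ring_scheme \<Rightarrow> ('a, 'b, 'm) module_scheme \<Rightarrow> 'b set \<Rightarrow> 'a set"
  where "Ann R M N = {r \<in> carrier R. scaled M r N = {\<zero>\<^bsub>M\<^esub>}}"

(* The intersection of a family is taken inside M, so that the empty family has intersection M.
   Repetitions in an indexed family affect neither the intersection nor the conclusion, so
   families are represented by sets of submodules. *)
definition completely_irreducible ::
    "('a, 'c) ring_scheme \<Rightarrow> ('a, 'b, 'm) module_scheme \<Rightarrow> 'b set \<Rightarrow> bool"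
  where "completely_irreducible R M L \<longleftrightarrow>
    submodule L R M \<and> L \<noteq> carrier M \<and>
    (\<forall>F. (\<forall>K\<in>F. submodule K R M) \<and> L = carrier M \<inter> \<Inter>F \<longrightarrow> L \<in> F)"

definition nonzero_submodule ::
    "('a, 'c) ring_scheme \<Rightarrow> ('a, 'b, 'm) module_scheme \<Rightarrow> 'b set \<Rightarrow> bool"
  where "nonzero_submodule R M N \<longleftrightarrow> submodule N R M \<and> N \<noteq> {\<zero>\<^bsub>M\<^esub>}"

definition second_submodule ::
    "('a, 'c) ring_scheme \<Rightarrow> ('a, 'b, 'm) module_scheme \<Rightarrow> 'b set \<Rightarrow> bool"
  where "second_submodule R M N \<longleftrightarrow>
    nonzero_submodule R M N \<and>
    (\<forall>a\<in>carrier R. (\<lambda>x. a \<odot>\<^bsub>M\<^esub> x) ` N = N \<or> (\<forall>x\<in>N. a \<odot>\<^bsub>M\<^esub> x = \<zero>\<^bsub>M\<^esub>))"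

definition weakly_second_submodule ::
    "('a, 'c) ring_scheme \<Rightarrow> ('a, 'b, 'm) module_scheme \<Rightarrow> 'b set \<Rightarrow> bool"
  where "weakly_second_submodule R M N \<longleftrightarrow>
    nonzero_submodule R M N \<and>
    (\<forall>r\<in>carrier R. \<forall>s\<in>carrier R. \<forall>K. submodule K R M \<and>
       scaled M (r \<otimes>\<^bsub>R\<^esub> s) N \<subseteq> K \<longrightarrow>
       scaled M r N \<subseteq> K \<or> scaled M s N \<subseteq> K)"

definition strongly_2_absorbing_second_submodule ::
    "('a, 'c) ring_scheme \<Rightarrow> ('a, 'b, 'm) module_scheme \<Rightarrow> 'b set \<Rightarrow> bool"
  where "strongly_2_absorbing_second_submodule R M N \<longleftrightarrow>
    nonzero_submodule R M N \<and>
    (\<forall>a\<in>carrier R. \<forall>b\<in>carrier R. \<forall>L1 L2.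
       completely_irreducible R M L1 \<and> completely_irreducible R M L2 \<and>
       scaled M (a \<otimes>\<^bsub>R\<^esub> b) N \<subseteq> L1 \<inter> L2 \<longrightarrow>
       scaled M a N \<subseteq> L1 \<inter> L2 \<or> scaled M b N \<subseteq> L1 \<inter> L2 \<or> a \<otimes>\<^bsub>R\<^esub> b \<in> Ann R M N)"

definition two_absorbing_second_submodule ::
    "('a, 'c) ring_scheme \<Rightarrow> ('a, 'b, 'm) module_scheme \<Rightarrow> 'b set \<Rightarrow> bool"
  where "two_absorbing_second_submodule R M N \<longleftrightarrow>
    nonzero_submodule R M N \<and>
    (\<forall>a\<in>carrier R. \<forall>b\<in>carrier R. \<forall>L. completely_irreducible R M L \<and>
       scaled M (a \<otimes>\<^bsub>R\<^esub> b) N \<subseteq> L \<longrightarrow>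
       scaled M a N \<subseteq> L \<or> scaled M b N \<subseteq> L \<or> a \<otimes>\<^bsub>R\<^esub> b \<in> Ann R M N)"

end

theory Submission
  imports "HOL-Computational_Algebra.Squarefree" "HOL-Algebra.IntRing" Defs
begin

text \<open>
  Everything rests on comparing the three submodules \<open>aN\<close>, \<open>bN\<close> and \<open>abN\<close>. For a second
  submodule \<open>aN\<close> is \<open>N\<close> or \<open>0\<close>, so that \<open>abN\<close> is \<open>bN\<close> or \<open>aN\<close>, and one of these two
  then lies in every \<open>K\<close> that contains \<open>abN\<close>. The second implication is the case
  \<open>K = L\<^sub>1 \<inter> L\<^sub>2\<close> and the third the case \<open>L\<^sub>1 = L\<^sub>2\<close>.

  The three counterexamples are whole modules over \<open>\<int>\<close>.

  \<^item> In \<open>\<rat> \<oplus> \<int>/2\<close> the multiples \<open>aN\<close> form the chain \<open>N \<supset> \<rat> \<supset> 0\<close> for \<open>a\<close> odd, even and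
    non-zero, and zero; \<open>abN\<close> is the smaller of \<open>aN\<close> and \<open>bN\<close>, but \<open>2N = \<rat>\<close> is neither
    \<open>N\<close> nor \<open>0\<close>.
  \<^item> In \<open>\<int>/p\<^sup>2\<close> a factor coprime to \<open>p\<close> acts bijectively, and two factors divisible by \<open>p\<close>
    have product \<open>0\<close>, which the strongly 2-absorbing condition forgives and the weakly second one
    does not; the submodule \<open>K = 0\<close> shows the failure.
  \<^item> In \<open>\<int>/n\<close> with \<open>n\<close> squarefree every submodule is a radical ideal, so that a completely
    irreducible one behaves like a prime ideal (\<open>two_absorbing_second_zmod_squarefree\<close>). If
    \<open>n\<close> has at least three prime factors, two of them, \<open>p\<close> and \<open>q\<close>, have \<open>pq \<noteq> 0\<close>, and the intersection of the maximal
    submodules \<open>(p)\<close> and \<open>(q)\<close> contains \<open>pq\<close> but neither \<open>p\<close> nor \<open>q\<close>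
    (\<open>not_strongly_2_absorbing_second_zmod\<close>).

  The last two use \<open>p = 2\<close> and \<open>n = 30\<close>.
\<close>

section \<open>The chain of implications\<close>

lemma scaled_mult:
  assumes "module R M" "N \<subseteq> carrier M" "a \<in> carrier R" "b \<in> carrier R"
  shows "scaled M (a \<otimes>\<^bsub>R\<^esub> b) N = scaled M a (scaled M b N)"
proof -
  interpret module R M by fact
  show ?thesis
    using assms(2-4) by (auto simp: scaled_def image_image smult_assoc1 subset_iff intro!: image_cong)
qed

lemma scaled_subsetI:
  assumes "\<And>x. x \<in> N \<Longrightarrow> \<exists>y\<in>N. r \<odot>\<^bsub>M\<^esub> x = s \<odot>\<^bsub>M\<^esub> y"
  shows "scaled M r N \<subseteq> scaled M s N"
  using assms by (auto simp: scaled_def image_iff)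

lemma submodule_Int:
  assumes "module R M" "submodule K R M" "submodule L R M"
  shows "submodule (K \<inter> L) R M"
proof -
  interpret module R M by fact
  note K = submoduleE[OF assms(2)] and L = submoduleE[OF assms(3)]
  have "\<zero>\<^bsub>M\<^esub> \<in> K" "\<zero>\<^bsub>M\<^esub> \<in> L"
    using assms(2,3)[THEN submodule.axioms(1), THEN subgroup.one_closed] by auto
  then show ?thesis
    by (intro submoduleI) (use K L in auto)
qed

text \<open>
  Among the submodules \<open>K\<close> that contain \<open>rsN\<close> the smallest is \<open>rsN\<close> itself, so this one decides
  the condition. The same remark, with \<open>rs\<close> outside the annihilator, gives the next lemma.
\<close>
lemma weakly_secondI:
  assumes "nonzero_submodule R M N"
    and "\<And>r s. r \<in> carrier R \<Longrightarrow> s \<in> carrier R \<Longrightarrow>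
           scaled M r N \<subseteq> scaled M (r \<otimes>\<^bsub>R\<^esub> s) N \<or> scaled M s N \<subseteq> scaled M (r \<otimes>\<^bsub>R\<^esub> s) N"
  shows "weakly_second_submodule R M N"
  using assms unfolding weakly_second_submodule_def by (meson subset_trans)

lemma strongly_2_absorbing_secondI:
  assumes "nonzero_submodule R M N"
    and "\<And>a b. a \<in> carrier R \<Longrightarrow> b \<in> carrier R \<Longrightarrow> a \<otimes>\<^bsub>R\<^esub> b \<notin> Ann R M N \<Longrightarrow>
           scaled M a N \<subseteq> scaled M (a \<otimes>\<^bsub>R\<^esub> b) N \<or> scaled M b N \<subseteq> scaled M (a \<otimes>\<^bsub>R\<^esub> b) N"
  shows "strongly_2_absorbing_second_submodule R M N"
  unfolding strongly_2_absorbing_second_submodule_def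
proof (intro conjI ballI allI impI, fact)
  fix a b L1 L2
  assume ab: "a \<in> carrier R" "b \<in> carrier R"
    and L: "completely_irreducible R M L1 \<and> completely_irreducible R M L2 \<and>
            scaled M (a \<otimes>\<^bsub>R\<^esub> b) N \<subseteq> L1 \<inter> L2"
  then show "scaled M a N \<subseteq> L1 \<inter> L2 \<or> scaled M b N \<subseteq> L1 \<inter> L2 \<or> a \<otimes>\<^bsub>R\<^esub> b \<in> Ann R M N"
    using assms(2)[OF ab] by (meson subset_trans)
qed

theorem second_imp_weakly_second:
  assumes "module R M" "second_submodule R M N"
  shows "weakly_second_submodule R M N"
proof (rule weakly_secondI)
  interpret module R M by fact
  show N: "nonzero_submodule R M N"
    using assms(2) by (simp add: second_submodule_def)
  then have sub: "N \<subseteq> carrier M" "submodule N R M"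
    by (auto simp: nonzero_submodule_def submoduleE(1))
  fix r s assume rs: "r \<in> carrier R" "s \<in> carrier R"
  have comm: "scaled M (r \<otimes>\<^bsub>R\<^esub> s) N = scaled M s (scaled M r N)"
    using scaled_mult[OF assms(1) sub(1) rs(2,1)] rs by (simp add: m_comm)
  show "scaled M r N \<subseteq> scaled M (r \<otimes>\<^bsub>R\<^esub> s) N \<or> scaled M s N \<subseteq> scaled M (r \<otimes>\<^bsub>R\<^esub> s) N"
  proof (cases "scaled M r N = N")
    case True
    with comm show ?thesis by simp
  next
    case False
    then have "\<forall>x\<in>N. r \<odot>\<^bsub>M\<^esub> x = \<zero>\<^bsub>M\<^esub>"
      using assms(2) rs by (auto simp: second_submodule_def scaled_def)
    moreover have "N \<noteq> {}"
      using submoduleE(2)[OF sub(2)] .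
    ultimately have "scaled M r N = {\<zero>\<^bsub>M\<^esub>}"
      by (auto simp: scaled_def)
    with comm rs show ?thesis
      by (simp add: scaled_def)
  qed
qed

theorem weakly_second_imp_strongly_2_absorbing_second:
  assumes "module R M" "weakly_second_submodule R M N"
  shows "strongly_2_absorbing_second_submodule R M N"
  using assms submodule_Int[OF assms(1)]
  unfolding weakly_second_submodule_def strongly_2_absorbing_second_submodule_def
    completely_irreducible_def
  by meson

theorem strongly_2_absorbing_second_imp_2_absorbing_second:
  assumes "strongly_2_absorbing_second_submodule R M N"
  shows "two_absorbing_second_submodule R M N"
  using assms
  unfolding strongly_2_absorbing_second_submodule_def two_absorbing_second_submodule_def
  by (metis Int_absorb)

section \<open>The module \<open>\<rat> \<oplus> \<int>/2\<close>\<close>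

definition rat_plus_zmod2 :: "(int, rat \<times> int) module" where
  "rat_plus_zmod2 = \<lparr>carrier = UNIV \<times> {0..<2},
     mult = (\<lambda>(p, x) (q, y). (p * q, x * y mod 2)), one = (1, 1), zero = (0, 0),
     add = (\<lambda>(p, x) (q, y). (p + q, (x + y) mod 2)),
     smult = (\<lambda>r (q, x). (of_int r * q, r * x mod 2))\<rparr>"

lemma module_rat_plus_zmod2: "module \<Z> rat_plus_zmod2"
proof (rule moduleI)
  show "cring \<Z>" by (rule int_is_cring)
  show "abelian_group rat_plus_zmod2"
  proof (rule abelian_groupI)
    fix x assume "x \<in> carrier rat_plus_zmod2"
    then show "\<exists>y\<in>carrier rat_plus_zmod2. y \<oplus>\<^bsub>rat_plus_zmod2\<^esub> x = \<zero>\<^bsub>rat_plus_zmod2\<^esub>"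
      \<comment> \<open>the second summand has characteristic 2, so only the rational component changes sign\<close>
      by (intro bexI[of _ "(- fst x, snd x)"]) (auto simp: rat_plus_zmod2_def)
  qed (auto simp: rat_plus_zmod2_def mod_simps algebra_simps)
qed (auto simp: rat_plus_zmod2_def mod_simps algebra_simps)

text \<open>
  Let \<open>N\<close> be the whole module. If \<open>r\<close> is odd then \<open>rN = N\<close> and \<open>rsN = sN\<close>. For \<open>r\<close>, \<open>s\<close> even and non-zero,
  \<open>rN = rsN = \<rat> \<oplus> 0\<close>, because \<open>s\<close> acts invertibly on \<open>\<rat>\<close> and both \<open>r\<close> and \<open>rs\<close> kill \<open>\<int>/2\<close>.
\<close>
lemma weakly_second_rat_plus_zmod2:
  "weakly_second_submodule \<Z> rat_plus_zmod2 (carrier rat_plus_zmod2)"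
proof (rule weakly_secondI)
  interpret module \<Z> rat_plus_zmod2 by (rule module_rat_plus_zmod2)
  let ?N = "carrier rat_plus_zmod2"
  have "(0, 1) \<in> ?N" "(0, 1) \<noteq> \<zero>\<^bsub>rat_plus_zmod2\<^esub>"
    by (auto simp: rat_plus_zmod2_def)
  then show "nonzero_submodule \<Z> rat_plus_zmod2 ?N"
    using carrier_is_submodule by (auto simp: nonzero_submodule_def)
  have odd: "scaled rat_plus_zmod2 s ?N \<subseteq> scaled rat_plus_zmod2 (r * s) ?N" if "odd r" for r s
  proof (rule scaled_subsetI)
    fix z assume z: "z \<in> ?N"
    obtain k where k: "r = 2 * k + 1" using \<open>odd r\<close> by (rule oddE)
    have "r * s * x mod 2 = s * x mod 2" for x
    proof -
      have "r * s * x = s * x + 2 * (k * s * x)" by (simp add: k algebra_simps)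
      then show ?thesis by (metis mod_mult_self2)
    qed
    moreover have "r \<noteq> 0" using \<open>odd r\<close> by auto
    ultimately show "\<exists>w\<in>?N. s \<odot>\<^bsub>rat_plus_zmod2\<^esub> z = (r * s) \<odot>\<^bsub>rat_plus_zmod2\<^esub> w"
      using z by (intro bexI[of _ "(fst z / of_int r, snd z)"]) (auto simp: rat_plus_zmod2_def)
  qed
  have even: "scaled rat_plus_zmod2 r ?N \<subseteq> scaled rat_plus_zmod2 (r * s) ?N"
    if "even r" "s \<noteq> 0" for r s
  proof (rule scaled_subsetI)
    fix z assume "z \<in> ?N"
    then show "\<exists>w\<in>?N. r \<odot>\<^bsub>rat_plus_zmod2\<^esub> z = (r * s) \<odot>\<^bsub>rat_plus_zmod2\<^esub> w"
      using that by (intro bexI[of _ "(fst z / of_int s, snd z)"]) (auto simp: rat_plus_zmod2_def)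
  qed
  fix r s :: int
  show "scaled rat_plus_zmod2 r ?N \<subseteq> scaled rat_plus_zmod2 (r \<otimes>\<^bsub>\<Z>\<^esub> s) ?N \<or>
        scaled rat_plus_zmod2 s ?N \<subseteq> scaled rat_plus_zmod2 (r \<otimes>\<^bsub>\<Z>\<^esub> s) ?N"
    proof (cases "s = 0")
    case False
    then show ?thesis using odd[of r s] even[of r s] by auto
  qed simp
qed

lemma not_second_rat_plus_zmod2:
  "\<not> second_submodule \<Z> rat_plus_zmod2 (carrier rat_plus_zmod2)"
proof
  let ?N = "carrier rat_plus_zmod2"
  assume "second_submodule \<Z> rat_plus_zmod2 ?N"
  then consider "(\<lambda>x. 2 \<odot>\<^bsub>rat_plus_zmod2\<^esub> x) ` ?N = ?N"
    | "\<forall>x\<in>?N. 2 \<odot>\<^bsub>rat_plus_zmod2\<^esub> x = \<zero>\<^bsub>rat_plus_zmod2\<^esub>"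
    unfolding second_submodule_def by (meson int_Zcarr)
  then show False
  proof cases
    case 1
    have "(0, 1) \<in> ?N" by (simp add: rat_plus_zmod2_def)
    then have "(0, 1) \<in> (\<lambda>x. 2 \<odot>\<^bsub>rat_plus_zmod2\<^esub> x) ` ?N" by (simp only: 1)
    then show False by (auto simp: rat_plus_zmod2_def)
  next
    case 2
    have "(1, 0) \<in> ?N" by (simp add: rat_plus_zmod2_def)
    with 2 have "2 \<odot>\<^bsub>rat_plus_zmod2\<^esub> (1, 0) = \<zero>\<^bsub>rat_plus_zmod2\<^esub>" by blast
    then show False by (simp add: rat_plus_zmod2_def)
  qed
qed

section \<open>The modules \<open>\<int>/n\<close>\<close>

definition zmod :: "int \<Rightarrow> (int, int) module" where
  "zmod n = \<lparr>carrier = {0..<n}, mult = (\<lambda>x y. x * y mod n), one = 1 mod n, zero = 0,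
     add = (\<lambda>x y. (x + y) mod n), smult = (\<lambda>r x. r * x mod n)\<rparr>"

lemma zmod_simps [simp]:
  "carrier (zmod n) = {0..<n}" "\<zero>\<^bsub>zmod n\<^esub> = 0"
  "x \<oplus>\<^bsub>zmod n\<^esub> y = (x + y) mod n" "r \<odot>\<^bsub>zmod n\<^esub> x = r * x mod n"
  by (simp_all add: zmod_def)

lemma scaled_zmod: "scaled (zmod n) r N = (\<lambda>x. r * x mod n) ` N"
  by (simp add: scaled_def)

lemma module_zmod:
  assumes "n > 0"
  shows "module \<Z> (zmod n)"
proof (rule moduleI)
  show "cring \<Z>" by (rule int_is_cring)
  show "abelian_group (zmod n)"
  proof (rule abelian_groupI)
    fix x assume "x \<in> carrier (zmod n)"
    show "\<exists>y\<in>carrier (zmod n). y \<oplus>\<^bsub>zmod n\<^esub> x = \<zero>\<^bsub>zmod n\<^esub>"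
      using assms by (intro bexI[of _ "- x mod n"]) (auto simp: mod_simps)
  qed (use assms in \<open>auto simp: mod_simps algebra_simps\<close>)
qed (use assms in \<open>auto simp: mod_simps algebra_simps\<close>)

lemma submodule_zmod_iff:
  assumes "n > 0"
  shows "submodule H \<Z> (zmod n) \<longleftrightarrow> H \<subseteq> {0..<n} \<and> 0 \<in> H \<and>
    (\<forall>x\<in>H. \<forall>y\<in>H. (x + y) mod n \<in> H) \<and> (\<forall>r. \<forall>x\<in>H. r * x mod n \<in> H)" (is "_ \<longleftrightarrow> ?rhs")
proof
  interpret module \<Z> "zmod n" by (rule module_zmod) fact
  assume H: "submodule H \<Z> (zmod n)"
  have "0 \<in> H"
    using subgroup.one_closed[OF submodule.axioms(1)[OF H]] by simp
  then show ?rhs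
    using submoduleE[OF H] by auto
next
  interpret module \<Z> "zmod n" by (rule module_zmod) fact
  assume H: ?rhs
  have neg: "\<ominus>\<^bsub>zmod n\<^esub> x = (- 1) * x mod n" if "x \<in> H" for x
  proof (rule minus_equality)
    show "(- 1 * x mod n) \<oplus>\<^bsub>zmod n\<^esub> x = \<zero>\<^bsub>zmod n\<^esub>" by (simp add: mod_simps)
  qed (use assms H that in auto)
  show "submodule H \<Z> (zmod n)"
  proof (rule submoduleI)
    show "\<ominus>\<^bsub>zmod n\<^esub> x \<in> H" if "x \<in> H" for x
      using neg[OF that] H that by metis
  qed (use H in auto)
qed

lemma submodule_zmod_carrier: "n > 0 \<Longrightarrow> submodule {0..<n} \<Z> (zmod n)"
  by (simp add: submodule_zmod_iff)

lemma nonzero_submodule_zmod_carrier: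
  assumes "n > 1"
  shows "nonzero_submodule \<Z> (zmod n) {0..<n}"
proof -
  have "1 \<in> {0..<n}" using assms by simp
  then have "{0..<n} \<noteq> {0}" by (metis singletonD zero_neq_one)
  then show ?thesis
    using assms by (simp add: nonzero_submodule_def submodule_zmod_carrier)
qed

lemma Ann_zmod_carrier:
  assumes "n > 0"
  shows "Ann \<Z> (zmod n) {0..<n} = {r. n dvd r}"
proof -
  have "scaled (zmod n) r {0..<n} = {0} \<longleftrightarrow> n dvd r" for r
  proof
    assume r: "scaled (zmod n) r {0..<n} = {0}"
    have "1 mod n \<in> {0..<n}"
      using assms by simp
    then have "r * (1 mod n) mod n = 0"
      using r by (auto simp: scaled_zmod)
    then show "n dvd r"
      by (simp add: mod_simps mod_eq_0_iff_dvd)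
  next
    assume "n dvd r"
    then show "scaled (zmod n) r {0..<n} = {0}"
      using assms by (auto simp: scaled_zmod image_iff intro!: bexI[of _ 0])
  qed
  then show ?thesis by (simp add: Ann_def)
qed

text \<open>An inverse \<open>u\<close> of \<open>a\<close> modulo \<open>n\<close> gives \<open>bx = ab(ux)\<close>.\<close>
lemma scaled_coprime_zmod:
  assumes "n > 0" "coprime a n"
  shows "scaled (zmod n) b {0..<n} \<subseteq> scaled (zmod n) (a * b) {0..<n}"
proof -
  obtain u v where "u * a + v * n = 1"
    using assms(2) bezout_int[of a n] by auto
  then have u: "u * a = 1 - v * n" by simp
  have "b * x mod n = a * b * (u * x mod n) mod n" for x
  proof -
    have "a * b * (u * x) = (u * a) * (b * x)" by (simp add: mult_ac)
    also have "\<dots> = b * x + n * (- v * b * x)"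
      unfolding u by (simp add: algebra_simps)
    finally have "a * b * (u * x) mod n = (b * x + n * (- v * b * x)) mod n" by simp
    also have "\<dots> = b * x mod n" by (rule mod_mult_self2)
    finally show ?thesis by (simp add: mod_simps)
  qed
  then show ?thesis
    using assms(1) by (intro scaled_subsetI bexI[of _ "u * x mod n" for x]) auto
qed

section \<open>Prime squares\<close>

lemma strongly_2_absorbing_second_zmod_prime_square:
  fixes p :: int
  assumes "prime p"
  shows "strongly_2_absorbing_second_submodule \<Z> (zmod (p ^ 2)) {0..<p ^ 2}"
proof (rule strongly_2_absorbing_secondI)
  have p: "p > 1" using assms prime_gt_1_int by blast
  then have n: "p ^ 2 > 1" by (simp add: one_less_power)
  then show "nonzero_submodule \<Z> (zmod (p ^ 2)) {0..<p ^ 2}"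
    by (rule nonzero_submodule_zmod_carrier)
  fix a b :: int
  assume "a \<otimes>\<^bsub>\<Z>\<^esub> b \<notin> Ann \<Z> (zmod (p ^ 2)) {0..<p ^ 2}"
  then have "\<not> p ^ 2 dvd a * b" using p by (simp add: Ann_zmod_carrier)
  then have "\<not> p dvd a \<or> \<not> p dvd b"
    by (auto simp: power2_eq_square mult_dvd_mono)
  then have "coprime a (p ^ 2) \<or> coprime b (p ^ 2)"
    using assms by (metis coprime_commute coprime_power_right_iff prime_imp_coprime)
  then show "scaled (zmod (p ^ 2)) a {0..<p ^ 2} \<subseteq> scaled (zmod (p ^ 2)) (a \<otimes>\<^bsub>\<Z>\<^esub> b) {0..<p ^ 2} \<or>
      scaled (zmod (p ^ 2)) b {0..<p ^ 2} \<subseteq> scaled (zmod (p ^ 2)) (a \<otimes>\<^bsub>\<Z>\<^esub> b) {0..<p ^ 2}"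
    using scaled_coprime_zmod[of "p ^ 2" a b] scaled_coprime_zmod[of "p ^ 2" b a] p
    by (auto simp: mult.commute[of b a])
qed

lemma not_weakly_second_zmod_square:
  fixes m :: int
  assumes "m > 1"
  shows "\<not> weakly_second_submodule \<Z> (zmod (m ^ 2)) {0..<m ^ 2}"
proof
  assume weak: "weakly_second_submodule \<Z> (zmod (m ^ 2)) {0..<m ^ 2}"
  have n: "m ^ 2 > m" using assms by (simp add: power2_eq_square)
  have "submodule {0} \<Z> (zmod (m ^ 2))"
    using assms by (simp add: submodule_zmod_iff)
  moreover have "scaled (zmod (m ^ 2)) (m \<otimes>\<^bsub>\<Z>\<^esub> m) {0..<m ^ 2} \<subseteq> {0}"
    by (auto simp: scaled_zmod power2_eq_square)
  ultimately have "scaled (zmod (m ^ 2)) m {0..<m ^ 2} \<subseteq> {0}"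
    using weak unfolding weakly_second_submodule_def by blast
  moreover have "1 \<in> {0..<m ^ 2}" using assms n by simp
  ultimately have "m * 1 mod m ^ 2 = 0"
    unfolding scaled_zmod by blast
  then show False using assms n by simp
qed

section \<open>Squarefree moduli\<close>

text \<open>
  Write \<open>d = ge\<close> and \<open>x = gf\<close> with \<open>g = gcd d x\<close>. From \<open>d dvd x\<^sup>2\<close> one gets \<open>e dvd gf\<^sup>2\<close>, hence
  \<open>e dvd g\<close>, so that \<open>e\<^sup>2\<close> divides the squarefree number \<open>d\<close>, and \<open>e\<close> is a unit.
\<close>
lemma squarefree_dvd_square:
  fixes d x :: int
  assumes "squarefree d" "d dvd x ^ 2"
  shows "d dvd x"
proof -
  define g where "g = gcd d x"
  have "d \<noteq> 0" using assms(1) by auto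
  then have g0: "g \<noteq> 0" by (simp add: g_def)
  obtain e f where e: "d = g * e" and f: "x = g * f" and cop: "coprime e f"
    using gcd_coprime_exists[of d x] g0 unfolding g_def by (metis mult.commute)
  have "g * e dvd g * (g * f ^ 2)"
    using assms(2) unfolding e f by (simp add: power2_eq_square mult_ac)
  then have "e dvd g * f ^ 2" using g0 by simp
  then have "e dvd g" using cop
    by (metis coprime_dvd_mult_left_iff coprime_power_right_iff)
  then have "e ^ 2 dvd d" by (simp add: e power2_eq_square mult_dvd_mono)
  then have "is_unit e" using assms(1) squarefreeD by blast
  then have "d dvd g" by (simp add: e mult_unit_dvd_iff)
  then show ?thesis by (metis dvd_trans gcd_dvd2 g_def)
qed

text \<open>
  Submodules of \<open>\<int>/n\<close> are ideals, and for squarefree \<open>n\<close> they are radical: \<open>gcd x\<^sup>2 n\<close> is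
  squarefree and divides \<open>x\<^sup>2\<close>, hence divides \<open>x\<close>, so that \<open>x\<close> is a multiple of \<open>x\<^sup>2\<close>
  modulo \<open>n\<close>.
\<close>
lemma submodule_zmod_radical:
  assumes "squarefree n" "n > 0" "submodule L \<Z> (zmod n)" "x \<in> {0..<n}" "x ^ 2 mod n \<in> L"
  shows "x \<in> L"
proof -
  obtain u v where uv: "u * x ^ 2 + v * n = gcd (x ^ 2) n"
    using bezout_int[of "x ^ 2" n] by blast
  have "gcd (x ^ 2) n dvd x"
    using squarefree_mono[OF gcd_dvd2 assms(1)] gcd_dvd1 by (rule squarefree_dvd_square)
  then obtain k where "x = gcd (x ^ 2) n * k" ..
  then have "x = k * u * x ^ 2 + n * (k * v)"
    unfolding uv[symmetric] by (simp only: algebra_simps)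
  then have "x mod n = (k * u * x ^ 2 + n * (k * v)) mod n" by simp
  also have "\<dots> = (k * u) * (x ^ 2 mod n) mod n" by (simp add: mod_simps)
  finally have "x mod n = (k * u) * (x ^ 2 mod n) mod n" .
  moreover have "(k * u) * (x ^ 2 mod n) mod n \<in> L"
    using assms(2,3,5) by (simp add: submodule_zmod_iff)
  ultimately show ?thesis using assms(4) by simp
qed

text \<open>The sum of \<open>L\<close> and the principal submodule generated by \<open>a\<close>.\<close>
definition adjoin :: "int \<Rightarrow> int set \<Rightarrow> int \<Rightarrow> int set" where
  "adjoin n L a = {y \<in> {0..<n}. \<exists>m. (y - a * m) mod n \<in> L}"

lemma submodule_adjoin:
  assumes "n > 0" "submodule L \<Z> (zmod n)"
  shows "submodule (adjoin n L a) \<Z> (zmod n)"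
proof -
  note L = assms(2)[unfolded submodule_zmod_iff[OF assms(1)]]
  have "(x + y) mod n \<in> adjoin n L a" if xy: "x \<in> adjoin n L a" "y \<in> adjoin n L a" for x y
  proof -
    obtain k m where "(x - a * k) mod n \<in> L" "(y - a * m) mod n \<in> L"
      using xy unfolding adjoin_def by blast
    then have "((x - a * k) mod n + (y - a * m) mod n) mod n \<in> L" using L by blast
    also have "((x - a * k) mod n + (y - a * m) mod n) mod n = ((x + y) mod n - a * (k + m)) mod n"
      by (simp only: mod_simps) (simp add: algebra_simps)
    finally show ?thesis using assms(1) by (auto simp: adjoin_def)
  qed
  moreover have "r * x mod n \<in> adjoin n L a" if x: "x \<in> adjoin n L a" for r x
  proof -
    obtain k where "(x - a * k) mod n \<in> L"
      using x unfolding adjoin_def by blast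
    then have "r * ((x - a * k) mod n) mod n \<in> L" using L by blast
    also have "r * ((x - a * k) mod n) mod n = (r * x mod n - a * (r * k)) mod n"
      by (simp add: mod_simps algebra_simps)
    finally show ?thesis using assms(1) by (auto simp: adjoin_def)
  qed
  moreover have "0 \<in> adjoin n L a"
    using L assms(1) by (auto simp: adjoin_def intro!: exI[of _ 0])
  moreover have "adjoin n L a \<subseteq> {0..<n}" by (auto simp: adjoin_def)
  ultimately show ?thesis
    using assms(1) by (simp add: submodule_zmod_iff)
qed

lemma subset_adjoin:
  assumes "n > 0" "submodule L \<Z> (zmod n)"
  shows "L \<subseteq> adjoin n L a"
proof
  fix x assume x: "x \<in> L"
  then have "x \<in> {0..<n}" using assms by (auto simp: submodule_zmod_iff)
  with x show "x \<in> adjoin n L a"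
    by (auto simp: adjoin_def intro!: exI[of _ 0])
qed

lemma scaled_subset_adjoin:
  assumes "n > 0" "submodule L \<Z> (zmod n)"
  shows "scaled (zmod n) a {0..<n} \<subseteq> adjoin n L a"
proof -
  have "0 \<in> L" using assms by (simp add: submodule_zmod_iff)
  then have "\<exists>m. (a * x mod n - a * m) mod n \<in> L" for x
    by (intro exI[of _ x]) (simp add: mod_simps)
  then show ?thesis
    using assms(1) by (auto simp: adjoin_def scaled_zmod)
qed

text \<open>
  If \<open>ab\<close> lies in the completely irreducible ideal \<open>L\<close>, then \<open>L = (L + (a)) \<inter> (L + (b))\<close>: the
  square of an element of the right side lies in \<open>L + (ab) = L\<close>, and \<open>L\<close> is radical. Hence \<open>L\<close> is one
  of the two factors and contains \<open>a\<close> or \<open>b\<close>.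
\<close>
lemma two_absorbing_second_zmod_squarefree:
  assumes "squarefree n" "n > 1"
  shows "two_absorbing_second_submodule \<Z> (zmod n) {0..<n}"
  unfolding two_absorbing_second_submodule_def
proof (intro conjI ballI allI impI)
  show "nonzero_submodule \<Z> (zmod n) {0..<n}"
    using assms(2) by (rule nonzero_submodule_zmod_carrier)
  fix a b L
  assume asm: "completely_irreducible \<Z> (zmod n) L \<and> scaled (zmod n) (a \<otimes>\<^bsub>\<Z>\<^esub> b) {0..<n} \<subseteq> L"
  have n: "n > 0" using assms(2) by simp
  have sub: "submodule L \<Z> (zmod n)"
    using asm by (simp add: completely_irreducible_def)
  note L = sub[unfolded submodule_zmod_iff[OF n]]
  have ab: "a * b * m mod n \<in> L" for m
  proof -
    have "1 \<in> {0..<n}" using assms(2) by simp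
    then have "a * b * 1 mod n \<in> scaled (zmod n) (a \<otimes>\<^bsub>\<Z>\<^esub> b) {0..<n}"
      by (simp only: scaled_zmod ring_record_simps monoid.simps) (rule imageI)
    then have "a * b * 1 mod n \<in> L" using asm by blast
    then have "m * (a * b * 1 mod n) mod n \<in> L" using L by blast
    then show ?thesis by (simp add: mod_simps mult_ac)
  qed
  have "x \<in> L" if x: "x \<in> adjoin n L a" "x \<in> adjoin n L b" for x
  proof -
    obtain k m where k: "(x - a * k) mod n \<in> L" and m: "(x - b * m) mod n \<in> L"
      using x unfolding adjoin_def by blast
    \<comment> \<open>with \<open>l = x - ak\<close> and \<open>l' = x - bm\<close> in \<open>L\<close>: \<open>x\<^sup>2 = x l + ak l' + abkm\<close>\<close>
    have "x * ((x - a * k) mod n) mod n \<in> L" "a * k * ((x - b * m) mod n) mod n \<in> L"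
      using L k m by blast+
    then have "((x * ((x - a * k) mod n) mod n + a * k * ((x - b * m) mod n) mod n) mod n
        + a * b * (k * m) mod n) mod n \<in> L"
      using L ab by blast
    also have "((x * ((x - a * k) mod n) mod n + a * k * ((x - b * m) mod n) mod n) mod n
        + a * b * (k * m) mod n) mod n = x ^ 2 mod n"
      by (simp only: mod_simps) (simp add: algebra_simps power2_eq_square)
    finally have "x ^ 2 mod n \<in> L" .
    moreover have "x \<in> {0..<n}" using x unfolding adjoin_def by blast
    ultimately show ?thesis
      using submodule_zmod_radical[OF assms(1) n sub] by blast
  qed
  then have "L = carrier (zmod n) \<inter> \<Inter>{adjoin n L a, adjoin n L b}"
    using subset_adjoin[OF n sub] L by auto
  moreover have "\<forall>K\<in>{adjoin n L a, adjoin n L b}. submodule K \<Z> (zmod n)"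
    using submodule_adjoin[OF n sub] by simp
  moreover have "\<And>F. \<forall>K\<in>F. submodule K \<Z> (zmod n) \<Longrightarrow> L = carrier (zmod n) \<inter> \<Inter>F \<Longrightarrow> L \<in> F"
    using asm unfolding completely_irreducible_def by simp
  ultimately have "L \<in> {adjoin n L a, adjoin n L b}"
    by metis
  then show "scaled (zmod n) a {0..<n} \<subseteq> L \<or> scaled (zmod n) b {0..<n} \<subseteq> L \<or>
      a \<otimes>\<^bsub>\<Z>\<^esub> b \<in> Ann \<Z> (zmod n) {0..<n}"
    using scaled_subset_adjoin[OF n sub] by (metis insert_iff singletonD)
qed

section \<open>Maximal submodules and the failure of the strong condition\<close>

text \<open>
  The only submodule strictly above a maximal one is the whole module, and an intersection of
  copies of the whole module is not proper.
\<close>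
lemma maximal_imp_completely_irreducible:
  assumes "submodule L R M" "L \<noteq> carrier M"
    and max: "\<And>K. submodule K R M \<Longrightarrow> L \<subset> K \<Longrightarrow> carrier M \<subseteq> K"
  shows "completely_irreducible R M L"
  unfolding completely_irreducible_def
proof (intro conjI allI impI)
  fix F assume F: "(\<forall>K\<in>F. submodule K R M) \<and> L = carrier M \<inter> \<Inter>F"
  show "L \<in> F"
  proof (rule ccontr)
    assume "L \<notin> F"
    with F have "\<forall>K\<in>F. L \<subset> K" by blast
    with F max have "carrier M \<subseteq> \<Inter>F" by blast
    with F assms(2) show False by blast
  qed
qed (use assms in auto)

lemma completely_irreducible_zmod_prime:
  fixes p n :: int
  assumes "prime p" "p dvd n" "n > 0"
  shows "completely_irreducible \<Z> (zmod n) {x \<in> {0..<n}. p dvd x}"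
proof (rule maximal_imp_completely_irreducible)
  let ?L = "{x \<in> {0..<n}. p dvd x}"
  show "submodule ?L \<Z> (zmod n)"
    using assms(2,3) by (auto simp: submodule_zmod_iff dvd_mod_iff)
  have n1: "n > 1" using prime_gt_1_int[OF assms(1)] zdvd_imp_le[OF assms(2,3)] by linarith
  have "\<not> p dvd 1" using assms(1) not_prime_unit by blast
  then have "1 \<notin> ?L" "1 \<in> carrier (zmod n)" using n1 by auto
  then show "?L \<noteq> carrier (zmod n)" by blast
  fix K assume sub: "submodule K \<Z> (zmod n)" and LK: "?L \<subset> K"
  note K = sub[unfolded submodule_zmod_iff[OF assms(3)]]
  obtain x where x: "x \<in> K" "\<not> p dvd x" using LK K by blast
  then have "gcd x p = 1"
    using prime_imp_coprime[OF assms(1)] by (simp add: gcd.commute)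
  then obtain u v where uv: "u * x + v * p = 1"
    using bezout_int[of x p] by auto
  show "carrier (zmod n) \<subseteq> K"
  proof
    fix y assume y: "y \<in> carrier (zmod n)"
    have "y * u * x mod n \<in> K" using K x(1) by blast
    moreover have "y * v * p mod n \<in> ?L"
      using assms by (auto simp: dvd_mod_iff)
    ultimately have "(y * u * x mod n + y * v * p mod n) mod n \<in> K"
      using K LK by blast
    also have "(y * u * x mod n + y * v * p mod n) mod n = y * (u * x + v * p) mod n"
      by (simp add: mod_simps algebra_simps)
    finally show "y \<in> K" using y uv by simp
  qed
qed

text \<open>
  The bound \<open>pq < n\<close> keeps \<open>pq\<close> out of the annihilator. The witnesses are the scalars \<open>p\<close> and \<open>q\<close>
  together with the maximal submodules \<open>(p)\<close> and \<open>(q)\<close>.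
\<close>
lemma not_strongly_2_absorbing_second_zmod:
  fixes p q n :: int
  assumes "prime p" "prime q" "p \<noteq> q" "p * q dvd n" "p * q < n"
  shows "\<not> strongly_2_absorbing_second_submodule \<Z> (zmod n) {0..<n}"
proof
  assume strong: "strongly_2_absorbing_second_submodule \<Z> (zmod n) {0..<n}"
  let ?P = "{x \<in> {0..<n}. p dvd x}" and ?Q = "{x \<in> {0..<n}. q dvd x}"
  have pq: "p > 1" "q > 1" using assms(1,2) prime_gt_1_int by blast+
  then have n: "n > 1" using assms(5) by (smt (verit) mult_pos_pos)
  have dvd: "p dvd n" "q dvd n" using assms(4) dvd_mult_left dvd_mult_right by blast+
  have "scaled (zmod n) (p \<otimes>\<^bsub>\<Z>\<^esub> q) {0..<n} \<subseteq> ?P \<inter> ?Q"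
    using n dvd by (auto simp: scaled_zmod dvd_mod_iff)
  moreover have "completely_irreducible \<Z> (zmod n) ?P" "completely_irreducible \<Z> (zmod n) ?Q"
    using assms dvd n by (intro completely_irreducible_zmod_prime; simp)+
  ultimately have "scaled (zmod n) p {0..<n} \<subseteq> ?P \<inter> ?Q \<or> scaled (zmod n) q {0..<n} \<subseteq> ?P \<inter> ?Q \<or>
      p \<otimes>\<^bsub>\<Z>\<^esub> q \<in> Ann \<Z> (zmod n) {0..<n}"
    using strong unfolding strongly_2_absorbing_second_submodule_def by blast
  moreover have "p * 1 mod n \<in> scaled (zmod n) p {0..<n}" "q * 1 mod n \<in> scaled (zmod n) q {0..<n}"
    using n unfolding scaled_zmod by (intro imageI; simp)+
  ultimately have "q dvd p * 1 mod n \<or> p dvd q * 1 mod n \<or> n dvd p * q"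
    using n by (auto simp: Ann_zmod_carrier)
  then have "q dvd p \<or> p dvd q \<or> n dvd p * q"
    using dvd by (simp add: dvd_mod_iff)
  moreover have "\<not> n dvd p * q"
    using assms(5) pq by (simp add: zdvd_not_zless)
  ultimately show False
    using assms(1-3) by (metis primes_dvd_imp_eq)
qed

lemma squarefree_30: "squarefree (30 :: int)"
proof -
  have "squarefree (2 * (3 * 5) :: int)"
    by (intro squarefree_mult_coprime squarefree_prime) (auto intro: prime_imp_coprime)
  then show ?thesis by simp
qed

theorem corollary3p19:
  fixes R :: "('a, 'c) ring_scheme" and M :: "('a, 'b, 'm) module_scheme" and N :: "'b set"
  assumes "module R M" and "submodule N R M"
  shows "(second_submodule R M N \<longrightarrow> weakly_second_submodule R M N) \<and>
    (weakly_second_submodule R M N \<longrightarrow> strongly_2_absorbing_second_submodule R M N) \<and>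
    (strongly_2_absorbing_second_submodule R M N \<longrightarrow> two_absorbing_second_submodule R M N) \<and>
    (\<exists>(R' :: int ring) (M' :: (int, rat \<times> int) module) N'.
       module R' M' \<and> submodule N' R' M' \<and>
       weakly_second_submodule R' M' N' \<and> \<not> second_submodule R' M' N') \<and>
    (\<exists>(R' :: int ring) (M' :: (int, int) module) N'.
       module R' M' \<and> submodule N' R' M' \<and>
       strongly_2_absorbing_second_submodule R' M' N' \<and> \<not> weakly_second_submodule R' M' N') \<and>
    (\<exists>(R' :: int ring) (M' :: (int, int) module) N'.
       module R' M' \<and> submodule N' R' M' \<and>
       two_absorbing_second_submodule R' M' N' \<and>
       \<not> strongly_2_absorbing_second_submodule R' M' N')"
proof (intro conjI impI)
  show "weakly_second_submodule R M N" if "second_submodule R M N"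
    using second_imp_weakly_second[OF assms(1) that] .
  show "strongly_2_absorbing_second_submodule R M N" if "weakly_second_submodule R M N"
    using weakly_second_imp_strongly_2_absorbing_second[OF assms(1) that] .
  show "two_absorbing_second_submodule R M N" if "strongly_2_absorbing_second_submodule R M N"
    using strongly_2_absorbing_second_imp_2_absorbing_second[OF that] .
  show "\<exists>(R' :: int ring) (M' :: (int, rat \<times> int) module) N'.
       module R' M' \<and> submodule N' R' M' \<and>
       weakly_second_submodule R' M' N' \<and> \<not> second_submodule R' M' N'"
    using module_rat_plus_zmod2 module.carrier_is_submodule[OF module_rat_plus_zmod2]
      weakly_second_rat_plus_zmod2 not_second_rat_plus_zmod2 by blast
  have "prime (2 :: int)" by simp
  then have "strongly_2_absorbing_second_submodule \<Z> (zmod (2 ^ 2)) {0..<2 ^ 2}"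
    "\<not> weakly_second_submodule \<Z> (zmod (2 ^ 2)) {0..<2 ^ 2}"
    by (intro strongly_2_absorbing_second_zmod_prime_square not_weakly_second_zmod_square; simp)+
  moreover have "module \<Z> (zmod (2 ^ 2))" "submodule {0..<2 ^ 2} \<Z> (zmod (2 ^ 2))"
    by (intro module_zmod submodule_zmod_carrier; simp)+
  ultimately show "\<exists>(R' :: int ring) (M' :: (int, int) module) N'.
       module R' M' \<and> submodule N' R' M' \<and>
       strongly_2_absorbing_second_submodule R' M' N' \<and> \<not> weakly_second_submodule R' M' N'"
    by blast
  have "two_absorbing_second_submodule \<Z> (zmod 30) {0..<30}"
    using squarefree_30 by (rule two_absorbing_second_zmod_squarefree) simp
  moreover have "\<not> strongly_2_absorbing_second_submodule \<Z> (zmod 30) {0..<30}"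
    by (rule not_strongly_2_absorbing_second_zmod[of 2 3]) simp_all
  moreover have "module \<Z> (zmod 30)" "submodule {0..<30} \<Z> (zmod 30)"
    by (intro module_zmod submodule_zmod_carrier; simp)+
  ultimately show "\<exists>(R' :: int ring) (M' :: (int, int) module) N'.
       module R' M' \<and> submodule N' R' M' \<and>
       two_absorbing_second_submodule R' M' N' \<and>
       \<not> strongly_2_absorbing_second_submodule R' M' N'"
    by blast
qed

end
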